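(* Let $n,m\ge 1$ be integers, $t>0$, $\Delta t=t/m$, let $G:\mathbb{R}\times\mathbb{R}^n\to\mathbb{R}^n$ be differentiable, and let $x_0\in\mathbb{R}^n$. Let $E(t,m,\cdot)$ be the implicit Euler map with $m$ uniform steps, let $x_1,\dots,x_m$ be the implicit Euler iterates started at $x_0$, and let $F_i$ be the residual of the $i$-th step (all as defined in the context). Assume that $E$ is differentially invertible at $(t,m,x_0)$. Then for every $v\in\mathbb{R}^n$, $$E'(t,m,x_0)^{-1}\cdot v=\frac{\partial F_1}{\partial x}(x_1,x_0,\Delta t)\cdot\frac{\partial F_2}{\partial x}(x_2,x_1,\Delta t)\cdots\frac{\partial F_m}{\partial x}(x_m,x_{m-1},\Delta t)\cdot v .$$
   Context: For $i=1,\dots,m$ the residual of the $i$-th implicit Euler step is $$F_i(x,z,\Delta t)=x-z-\Delta t\cdot G(i\,\Delta t,x),\qquad x,z\in\mathbb{R}^n,$$ and $\frac{\partial F_i}{\partial x}(x,z,\Delta t)=I_n-\Delta t\cdot\frac{\partial G}{\partial x}(i\,\Delta t,x)\in\mathbb{R}^{n\times n}$ denotes its Jacobian with respect to its first argument. The implicit Euler iterates $x_1,\dots,x_m$ for the system $\frac{dx}{dt}=G(t,x(t))$ with initial state $x_0$ satisfy $F_i(x_i,x_{i-1},\Delta t)=0$ for $i=1,\dots,m$. Standing assumption: for each $i$ this equation defines $x_i$ implicitly as a differentiable function of $x_{i-1}$, i.e. there are an open neighborhood $U_{i-1}$ of $x_{i-1}$ and a map $\varphi_i:U_{i-1}\to\mathbb{R}^n$,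 differentiable at $x_{i-1}$, with $\varphi_i(x_{i-1})=x_i$ and $F_i(\varphi_i(z),z,\Delta t)=0$ for all $z\in U_{i-1}$. For $x$ in a neighborhood of $x_0$, the implicit Euler map is $E(t,m,x)=\varphi_m(\cdots\varphi_1(x)\cdots)$, so that $E(t,m,x_0)=x_m$. $E'(t,m,x_0)=\frac{dE}{dx}(t,m,x_0)\in\mathbb{R}^{n\times n}$ is the Jacobian with respect to the initial state. $E$ is called differentially invertible at $(t,m,x_0)$ if it is differentiable with respect to the initial state there and $E'(t,m,x_0)$ is invertible. *)

theory Defs
  imports "HOL-Analysis.Analysis"
begin

definition euler_residual ::
  "(real \<times> (real ^ 'n) \<Rightarrow> real ^ 'n) \<Rightarrow> nat \<Rightarrow> real ^ 'n \<Rightarrow> real ^ 'n \<Rightarrow> real \<Rightarrow> real ^ 'n"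
  where "euler_residual G i x z dt = x - z - dt *\<^sub>R G (real i * dt, x)"

definition residual_jacobian ::
  "(real \<times> (real ^ 'n) \<Rightarrow> real ^ 'n) \<Rightarrow> nat \<Rightarrow> real ^ 'n \<Rightarrow> real ^ 'n \<Rightarrow> real \<Rightarrow> real ^ 'n ^ 'n"
  where "residual_jacobian G i x z dt = jacobian (\<lambda>y. euler_residual G i y z dt) (at x)"

lemma residual_jacobian_eq:
  fixes G :: "real \<times> (real ^ 'n) \<Rightarrow> real ^ 'n"
  assumes "G differentiable at (real i * dt, x)"
  shows "residual_jacobian G i x z dt =
    mat 1 - dt *\<^sub>R jacobian (\<lambda>y. G (real i * dt, y)) (at x)"
proof -
  let ?g = "\<lambda>y. G (real i * dt, y)"
  have "(G \<circ> (\<lambda>y. (real i * dt, y))) differentiable at x"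
    by (rule differentiable_chain_at)
      (use assms in \<open>auto simp: differentiable_def intro!: exI derivative_eq_intros\<close>)
  then have "(?g has_derivative (\<lambda>h. jacobian ?g (at x) *v h)) (at x)"
    by (simp add: o_def jacobian_works)
  then have "((\<lambda>y. euler_residual G i y z dt) has_derivative
      (\<lambda>h. h - dt *\<^sub>R (jacobian ?g (at x) *v h))) (at x)"
    unfolding euler_residual_def by (auto intro!: derivative_eq_intros)
  then have "frechet_derivative (\<lambda>y. euler_residual G i y z dt) (at x) =
      (\<lambda>h. (mat 1 - dt *\<^sub>R jacobian ?g (at x)) *v h)"
    by (subst frechet_derivative_at[symmetric])
      (auto simp: fun_eq_iff matrix_vector_mult_diff_rdistrib scaleR_matrix_vector_assoc)
  then show ?thesis
    by (simp add: residual_jacobian_def jacobian_def)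
qed

text \<open>
  \<open>x 0\<close> is the initial state and \<open>x 1, \<dots>, x m\<close> are the iterates.  The implicit functions
  \<open>\<phi> i\<close> are total in HOL, but they are constrained only on the neighbourhood \<open>U\<close>
  of \<open>x (i - 1)\<close>; since each \<open>\<phi> i\<close> is continuous at \<open>x (i - 1)\<close>, the composition
  of the restricted maps is defined near \<open>x 0\<close> and agrees there with \<open>euler_map \<phi> m\<close>.
\<close>

definition implicit_euler ::
  "(real \<times> (real ^ 'n) \<Rightarrow> real ^ 'n) \<Rightarrow> real \<Rightarrow> nat \<Rightarrow> (nat \<Rightarrow> real ^ 'n)
    \<Rightarrow> (nat \<Rightarrow> real ^ 'n \<Rightarrow> real ^ 'n) \<Rightarrow> bool"
  where "implicit_euler G dt m x \<phi> \<longleftrightarrow>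
    (\<forall>i\<in>{1..m}.
      euler_residual G i (x i) (x (i - 1)) dt = 0 \<and>
      (\<exists>U. open U \<and> x (i - 1) \<in> U \<and>
        \<phi> i differentiable at (x (i - 1)) \<and>
        \<phi> i (x (i - 1)) = x i \<and>
        (\<forall>z\<in>U. euler_residual G i (\<phi> i z) z dt = 0)))"

primrec euler_map :: "(nat \<Rightarrow> real ^ 'n \<Rightarrow> real ^ 'n) \<Rightarrow> nat \<Rightarrow> real ^ 'n \<Rightarrow> real ^ 'n"
  where
    "euler_map \<phi> 0 z = z"
  | "euler_map \<phi> (Suc k) z = \<phi> (Suc k) (euler_map \<phi> k z)"

definition differentially_invertible :: "(real ^ 'n \<Rightarrow> real ^ 'n) \<Rightarrow> real ^ 'n \<Rightarrow> bool"
  where "differentially_invertible E z \<longleftrightarrow>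
    E differentiable at z \<and> invertible (jacobian E (at z))"

definition matrix_prod_list :: "(real ^ 'n ^ 'n) list \<Rightarrow> real ^ 'n ^ 'n"
  where "matrix_prod_list As = foldr (**) As (mat 1)"

end

theory Submission
  imports Defs
begin

text \<open>
  Differentiating \<open>F\<^sub>i (\<phi>\<^sub>i z) z \<Delta>t = 0\<close> at \<open>z = x\<^sub>i\<^sub>-\<^sub>1\<close> shows that the Jacobian of \<open>F\<^sub>i\<close> in its
  first argument is a left inverse of the Jacobian of \<open>\<phi>\<^sub>i\<close>.  By the chain rule the Jacobian
  of the Euler map is the product of the latter in reverse order, so the partial products
  telescope to the identity; for square matrices a left inverse is the inverse.
\<close>

lemma jacobian_eqI:
  fixes f :: "real ^ 'n \<Rightarrow> real ^ 'm"
  assumes "(f has_derivative (\<lambda>h. A *v h)) (at x)"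
  shows "jacobian f (at x) = A"
  using frechet_derivative_at[OF assms] by (metis jacobian_def matrix_of_matrix_vector_mul)

lemma jacobian_compose:
  fixes f :: "real ^ 'n \<Rightarrow> real ^ 'm" and g :: "real ^ 'm \<Rightarrow> real ^ 'k"
  assumes "f differentiable at x" and "g differentiable at (f x)"
  shows "jacobian (g \<circ> f) (at x) = jacobian g (at (f x)) ** jacobian f (at x)"
proof (rule jacobian_eqI)
  show "(g \<circ> f has_derivative (\<lambda>h. (jacobian g (at (f x)) ** jacobian f (at x)) *v h)) (at x)"
    using diff_chain_at[OF assms[unfolded jacobian_works]]
    by (simp add: o_def matrix_vector_mul_assoc)
qed

text \<open>A one-sided inverse of a square matrix is two-sided, so \<open>B\<close> witnesses the
  choice made in \<open>matrix_inv\<close>. Multiplying \<open>A ** matrix_inv A = mat 1\<close> by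
  \<open>B\<close> from the left then cancels \<open>A\<close>.\<close>

lemma matrix_inv_eq_left_inverse:
  fixes A B :: "real ^ 'n ^ 'n"
  assumes "B ** A = mat 1"
  shows "matrix_inv A = B"
proof -
  have "A ** B = mat 1"
    using assms matrix_left_right_inverse by blast
  then have "A ** matrix_inv A = mat 1"
    unfolding matrix_inv_def
    using someI[of "\<lambda>C. A ** C = mat 1 \<and> C ** A = mat 1" B] assms by blast
  then have "B ** (A ** matrix_inv A) = B"
    by simp
  then show ?thesis
    by (simp only: matrix_mul_assoc assms matrix_mul_lid)
qed

lemma matrix_prod_list_snoc:
  "matrix_prod_list (As @ [A]) = matrix_prod_list As ** A"
proof -
  \<comment> \<open>Appending \<open>A\<close> to the list amounts to starting the fold at
    \<open>A\<close> instead of \<open>mat 1\<close>.\<close>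
  have "foldr (**) As A = foldr (**) As (mat 1) ** A"
    by (induction As) (simp_all add: matrix_mul_assoc)
  then show ?thesis
    by (simp add: matrix_prod_list_def)
qed

text \<open>With the second argument frozen at \<open>w\<close>, the residual along
  \<open>\<phi>\<close> equals \<open>y - w\<close> on the open set \<open>U\<close>, so its
  derivative at \<open>z\<close> is the identity; the chain rule factors that derivative. The point
  \<open>w\<close> is arbitrary because it enters the residual only as an additive constant.\<close>

lemma residual_jacobian_mult_implicit_jacobian:
  fixes G :: "real \<times> (real ^ 'n) \<Rightarrow> real ^ 'n"
  assumes G: "G differentiable at (real i * dt, \<phi> z)"
    and \<phi>: "\<phi> differentiable at z"
    and U: "open U" "z \<in> U" "\<And>y. y \<in> U \<Longrightarrow> euler_residual G i (\<phi> y) y dt = 0"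
  shows "residual_jacobian G i (\<phi> z) w dt ** jacobian \<phi> (at z) = mat 1"
proof -
  let ?r = "\<lambda>y. euler_residual G i y w dt"
  \<comment> \<open>Joint differentiability of \<open>G\<close> passes to the slice at fixed time,
    since the slice embedding is affine.\<close>
  have "(G \<circ> (\<lambda>y. (real i * dt, y))) differentiable at (\<phi> z)"
    by (rule differentiable_chain_at)
      (use G in \<open>auto simp: differentiable_def intro!: exI derivative_eq_intros\<close>)
  then have "?r differentiable at (\<phi> z)"
    unfolding euler_residual_def by (simp add: o_def)
  then have "jacobian (?r \<circ> \<phi>) (at z) = residual_jacobian G i (\<phi> z) w dt ** jacobian \<phi> (at z)"
    unfolding residual_jacobian_def using \<phi> by (intro jacobian_compose)
  moreover have "jacobian (?r \<circ> \<phi>) (at z) = mat 1"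
  proof (rule jacobian_eqI)
    have "((\<lambda>y. y - w) has_derivative (\<lambda>h. mat 1 *v h)) (at z)"
      by (auto intro!: derivative_eq_intros)
    \<comment> \<open>The vanishing residual gives
      \<open>\<phi> y - dt *\<^sub>R G (real i * dt, \<phi> y) = y\<close>; subtract
      \<open>w\<close>.\<close>
    moreover have "y - w = (?r \<circ> \<phi>) y" if "y \<in> U" for y
      using U(3)[OF that] by (simp add: euler_residual_def algebra_simps)
    ultimately show "(?r \<circ> \<phi> has_derivative (\<lambda>h. mat 1 *v h)) (at z)"
      by (rule has_derivative_transform_within_open[OF _ U(1,2)])
  qed
  ultimately show ?thesis
    by simp
qed

lemma implicit_euler_Suc:
  "implicit_euler G dt (Suc k) x \<phi> \<Longrightarrow> implicit_euler G dt k x \<phi>"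
  by (simp add: implicit_euler_def)

text \<open>The three claims go through one induction: the value \<open>x k\<close> and
  differentiability at \<open>x 0\<close> are what the chain rule needs in the next step.\<close>

lemma implicit_euler_mapD:
  assumes "G differentiable_on UNIV" and "implicit_euler G dt m x \<phi>"
  shows "euler_map \<phi> m (x 0) = x m \<and> euler_map \<phi> m differentiable at (x 0) \<and>
    matrix_prod_list (map (\<lambda>i. residual_jacobian G i (x i) (x (i - 1)) dt) [1..<Suc m]) **
      jacobian (euler_map \<phi> m) (at (x 0)) = mat 1"
  using assms(2)
proof (induction m)
  case 0
  have "jacobian (\<lambda>z. z) (at (x 0)) = mat 1"
    by (rule jacobian_eqI) (simp add: has_derivative_ident)
  then show ?case
    by (simp add: matrix_prod_list_def)
next
  case (Suc k)
  let ?J = "\<lambda>i. residual_jacobian G i (x i) (x (i - 1)) dt"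
  let ?P = "matrix_prod_list (map ?J [1..<Suc k])"
  have IH: "euler_map \<phi> k (x 0) = x k" "euler_map \<phi> k differentiable at (x 0)"
      "?P ** jacobian (euler_map \<phi> k) (at (x 0)) = mat 1"
    using Suc.IH implicit_euler_Suc[OF Suc.prems] by auto
  obtain U where U: "open U" "x k \<in> U" "\<And>z. z \<in> U \<Longrightarrow> euler_residual G (Suc k) (\<phi> (Suc k) z) z dt = 0"
    and \<phi>: "\<phi> (Suc k) differentiable at (x k)" "\<phi> (Suc k) (x k) = x (Suc k)"
    using bspec[OF Suc.prems[unfolded implicit_euler_def], of "Suc k"] by auto
  have G: "G differentiable at p" for p
    using assms(1) unfolding differentiable_on_def by blast
  have inv: "?J (Suc k) ** jacobian (\<phi> (Suc k)) (at (x k)) = mat 1"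
    using residual_jacobian_mult_implicit_jacobian[OF G \<phi>(1) U] by (simp add: \<phi>(2))
  have comp: "euler_map \<phi> (Suc k) = \<phi> (Suc k) \<circ> euler_map \<phi> k"
    by (simp add: fun_eq_iff)
  have "jacobian (euler_map \<phi> (Suc k)) (at (x 0)) =
      jacobian (\<phi> (Suc k)) (at (x k)) ** jacobian (euler_map \<phi> k) (at (x 0))"
    unfolding comp using IH \<phi> by (simp add: jacobian_compose)
  moreover have "matrix_prod_list (map ?J [1..<Suc (Suc k)]) = ?P ** ?J (Suc k)"
    by (simp add: matrix_prod_list_snoc)
  \<comment> \<open>Reassociation brings the two new factors together in the middle, where
    \<open>inv\<close> cancels them and leaves the induction hypothesis.\<close>
  ultimately have "matrix_prod_list (map ?J [1..<Suc (Suc k)]) **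
      jacobian (euler_map \<phi> (Suc k)) (at (x 0)) =
      ?P ** (?J (Suc k) ** jacobian (\<phi> (Suc k)) (at (x k))) ** jacobian (euler_map \<phi> k) (at (x 0))"
    by (simp only: matrix_mul_assoc)
  then have "matrix_prod_list (map ?J [1..<Suc (Suc k)]) **
      jacobian (euler_map \<phi> (Suc k)) (at (x 0)) = mat 1"
    by (simp only: inv matrix_mul_rid IH(3))
  moreover have "euler_map \<phi> (Suc k) differentiable at (x 0)"
    unfolding comp using IH \<phi> by (intro differentiable_chain_at) auto
  moreover have "euler_map \<phi> (Suc k) (x 0) = x (Suc k)"
    using IH(1) \<phi>(2) by simp
  ultimately show ?case
    by blast
qed

theorem theorem3p2:
  fixes G :: "real \<times> (real ^ 'n) \<Rightarrow> real ^ 'n"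
    and t dt :: real
    and m :: nat
    and x0 v :: "real ^ 'n"
    and x :: "nat \<Rightarrow> real ^ 'n"
    and \<phi> :: "nat \<Rightarrow> real ^ 'n \<Rightarrow> real ^ 'n"
  assumes "m \<ge> 1"
    and "t > 0"
    and "dt = t / real m"
    and "G differentiable_on UNIV"
    and "x 0 = x0"
    and "implicit_euler G dt m x \<phi>"
    and "differentially_invertible (euler_map \<phi> m) x0"
  shows "matrix_inv (jacobian (euler_map \<phi> m) (at x0)) *v v =
    matrix_prod_list (map (\<lambda>i. residual_jacobian G i (x i) (x (i - 1)) dt) [1..<Suc m]) *v v"
  using implicit_euler_mapD[OF assms(4,6)] unfolding assms(5)
  by (elim conjE, subst matrix_inv_eq_left_inverse) (assumption, rule refl)

end
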